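(* Let $f\colon \mathbb{S}^{n\times n}\to\mathbb{R}$ be twice continuously differentiable. Let $Y\in\mathrm{St}(d,p)^m$ be a full-rank (rank $p$) critical point of $(\mathrm{RP}_p)$ such that $X=YY^\top$ is not a KKT point of $(\mathrm{P})$. Let $p_+>p$ be an integer and let $Y_+=\begin{pmatrix}Y & 0_{n\times(p_+-p)}\end{pmatrix}\in\mathrm{St}(d,p_+)^m$. Then: (a) $g(Y_+)=g(Y)$; (b) $Y_+$ is a critical point of $(\mathrm{RP}_{p_+})$; and (c) for all $u\in\mathbb{R}^n$ such that $u^\top S(X)u<0$, $\dot Y=u\,e_{p+1}^\top$ belongs to $\mathrm{T}_{Y_+}\mathrm{St}(d,p_+)^m$ and is a descent direction for $g$ from $Y_+$, where $e_{p+1}\in\mathbb{R}^{p_+}$ is the vector whose entries are all zero except for the $(p+1)$st entry, equal to $1$.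
   Context: Integers satisfy $m\ge 1$, $1\le d\le p\le n=md$. $\mathbb{S}^{k\times k}$ is the space of real symmetric $k\times k$ matrices. Matrices $M\in\mathbb{R}^{n\times n}$ are viewed as $m\times m$ block matrices with blocks $M_{ij}\in\mathbb{R}^{d\times d}$; for any $q\geq d$, $Y\in\mathbb{R}^{n\times q}$ is viewed as a stack of slices $Y_1,\dots,Y_m\in\mathbb{R}^{d\times q}$. $\nabla f(X)\in\mathbb{S}^{n\times n}$ is the Euclidean gradient of $f$ with respect to $\langle A,B\rangle=\operatorname{trace}(A^\top B)$. Define $\mathrm{St}(d,q)^m=\{Y\in\mathbb{R}^{n\times q}: Y_iY_i^\top=I_d,\ i=1,\dots,m\}$ and $\mathcal{C}=\{X\in\mathbb{S}^{n\times n}: X\succeq 0,\ X_{ii}=I_d,\ i=1,\dots,m\}$. Problem $(\mathrm{P})$: minimize $f(X)$ over $X\in\mathcal{C}$. Problem $(\mathrm{RP}_q)$: minimize $g(Y)=f(YY^\top)$ over $Y\in\mathrm{St}(d,q)^m$ (the same letter $g$ is used for every $q$). $\operatorname{symblockdiag}(M)$ is the matrix with diagonal blocks $(M_{ii}+M_{ii}^\top)/2$ and all other blocks zero. For $X\in\mathcal{C}$, $S(X)=\nabla f(X)-\operatorname{symblockdiag}(\nabla f(X)X)$. The tangent space is $\mathrm{T}_Y\mathrm{St}(d,q)^m=\{\dot Y\in\mathbb{R}^{n\times q}:\operatorname{symblockdiag}(\dot YY^\top+Y\dot Y^\top)=0\}$. $Y\in\mathrm{St}(d,q)^m$ is a critical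 point of $(\mathrm{RP}_q)$ if the Riemannian gradient of $g$ vanishes, i.e. $S(YY^\top)Y=0$. $X\in\mathcal{C}$ is a KKT point of $(\mathrm{P})$ if there exist $\hat S\in\mathbb{S}^{n\times n}$ and a symmetric block-diagonal (with $d\times d$ blocks) $\hat\Lambda\in\mathbb{S}^{n\times n}$ such that $\hat SX=0$, $\hat S=\nabla f(X)+\hat\Lambda$ and $\hat S\succeq 0$. Retraction: for $\dot Y\in\mathrm{T}_Y\mathrm{St}(d,q)^m$, $\mathrm{Retraction}_Y(\dot Y)\in\mathrm{St}(d,q)^m$ has $i$th slice $U_iV_i^\top$, where $Y_i+\dot Y_i=U_i\Sigma_iV_i^\top$ is a thin singular value decomposition. A tangent vector $\dot Y$ at $Y$ is a descent direction for $g$ from $Y$ if there exists $t_0>0$ such that $g(\mathrm{Retraction}_Y(t\dot Y))<g(Y)$ for all $t\in(0,t_0)$. *)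

theory Defs
  imports "HOL-Analysis.Analysis"
begin

(* Rows of an n x q matrix with n = m d are indexed by pairs (i, a): block number i :: 'm and
   position a :: 'd inside the block. *)

definition slice :: "'m \<Rightarrow> real^'q^('m::finite \<times> 'd::finite) \<Rightarrow> real^'q^'d" where
  "slice i Y = (\<chi> a. Y $ (i, a))"

definition blk :: "'m \<Rightarrow> 'm \<Rightarrow> real^('m::finite \<times> 'd::finite)^('m \<times> 'd) \<Rightarrow> real^'d^'d" where
  "blk i j M = (\<chi> a b. M $ (i, a) $ (j, b))"

definition symmetric_matrices :: "(real^'n^'n) set" where
  "symmetric_matrices = {M. transpose M = M}"

definition psd :: "real^'n^'n \<Rightarrow> bool" where
  "psd M \<longleftrightarrow> M \<in> symmetric_matrices \<and> (\<forall>u. 0 \<le> u \<bullet> (M *v u))"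

definition St :: "(real^'q^('m::finite \<times> 'd::finite)) set" where
  "St = {Y. \<forall>i. slice i Y ** transpose (slice i Y) = mat 1}"

definition feasible :: "(real^('m::finite \<times> 'd::finite)^('m \<times> 'd)) set" where
  "feasible = {X. psd X \<and> (\<forall>i. blk i i X = mat 1)}"

definition symblockdiag ::
    "real^('m::finite \<times> 'd::finite)^('m \<times> 'd) \<Rightarrow> real^('m \<times> 'd)^('m \<times> 'd)" where
  "symblockdiag M = (\<chi> r c. if fst r = fst c
     then ((1/2) *\<^sub>R (blk (fst r) (fst r) M + transpose (blk (fst r) (fst r) M))) $ snd r $ snd c
     else 0)"

definition block_diagonal :: "real^('m::finite \<times> 'd::finite)^('m \<times> 'd) \<Rightarrow> bool" where
  "block_diagonal M \<longleftrightarrow> (\<forall>i j. i \<noteq> j \<longrightarrow> blk i j M = 0)"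

(* Intended for a linear subspace E. The derivatives f' X and f'' X are operators on the whole
   space, but only their restrictions to E are constrained; every operator on E has such an
   extension, so this is C^2 regularity of f viewed as a function on the vector space E. *)
definition twice_continuously_differentiable_on ::
    "'a::real_normed_vector set \<Rightarrow> ('a \<Rightarrow> real) \<Rightarrow> bool" where
  "twice_continuously_differentiable_on E f \<longleftrightarrow>
     (\<exists>(f' :: 'a \<Rightarrow> 'a \<Rightarrow>\<^sub>L real) (f'' :: 'a \<Rightarrow> 'a \<Rightarrow>\<^sub>L ('a \<Rightarrow>\<^sub>L real)).
        (\<forall>X\<in>E. (f has_derivative blinfun_apply (f' X)) (at X within E)) \<and>
        (\<forall>X\<in>E. (f' has_derivative blinfun_apply (f'' X)) (at X within E)) \<and>
        continuous_on E f'')"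

(* The gradient of f as a function on the space of symmetric matrices; the values of f at
   nonsymmetric matrices are irrelevant. *)
definition gradient :: "(real^'n^'n \<Rightarrow> real) \<Rightarrow> real^'n^'n \<Rightarrow> real^'n^'n" where
  "gradient f X = (THE G. G \<in> symmetric_matrices \<and>
     (f has_derivative (\<lambda>H. trace (transpose G ** H))) (at X within symmetric_matrices))"

definition S ::
    "(real^('m::finite \<times> 'd::finite)^('m \<times> 'd) \<Rightarrow> real) \<Rightarrow>
     real^('m \<times> 'd)^('m \<times> 'd) \<Rightarrow> real^('m \<times> 'd)^('m \<times> 'd)" where
  "S f X = gradient f X - symblockdiag (gradient f X ** X)"

definition g :: "(real^'n^'n \<Rightarrow> real) \<Rightarrow> real^'q^'n \<Rightarrow> real" where
  "g f Y = f (Y ** transpose Y)"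

definition tangent_space ::
    "real^'q^('m::finite \<times> 'd::finite) \<Rightarrow> (real^'q^('m \<times> 'd)) set" where
  "tangent_space Y = {D. symblockdiag (D ** transpose Y + Y ** transpose D) = 0}"

definition critical_point ::
    "(real^('m::finite \<times> 'd::finite)^('m \<times> 'd) \<Rightarrow> real) \<Rightarrow> real^'q^('m \<times> 'd) \<Rightarrow> bool" where
  "critical_point f Y \<longleftrightarrow> Y \<in> St \<and> S f (Y ** transpose Y) ** Y = 0"

definition KKT_point ::
    "(real^('m::finite \<times> 'd::finite)^('m \<times> 'd) \<Rightarrow> real) \<Rightarrow> real^('m \<times> 'd)^('m \<times> 'd) \<Rightarrow> bool" where
  "KKT_point f X \<longleftrightarrow> X \<in> feasible \<and>
     (\<exists>S' \<Lambda>. S' \<in> symmetric_matrices \<and> \<Lambda> \<in> symmetric_matrices \<and> block_diagonal \<Lambda> \<and>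
        S' ** X = 0 \<and> S' = gradient f X + \<Lambda> \<and> psd S')"

(* A = U \<Sigma> V^T for a wide matrix A (at least as many columns as rows). The singular values are
   not required to be sorted, as the index type 'd carries no order. *)
definition thin_svd :: "real^'q^'d \<Rightarrow> real^'d^'d \<Rightarrow> real^'d^'d \<Rightarrow> real^'d^'q \<Rightarrow> bool" where
  "thin_svd A U \<Sigma> V \<longleftrightarrow>
     orthogonal_matrix U \<and> transpose V ** V = mat 1 \<and>
     (\<forall>a b. a \<noteq> b \<longrightarrow> \<Sigma> $ a $ b = 0) \<and> (\<forall>a. 0 \<le> \<Sigma> $ a $ a) \<and>
     A = U ** \<Sigma> ** transpose V"

(* U V^T does not depend on the choice of the decomposition when A has full row rank, which is
   the case for the slices of Y + D with Y in St and D tangent at Y. *)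
definition svd_projection :: "real^'q^'d \<Rightarrow> real^'q^'d" where
  "svd_projection A = (SOME W. \<exists>U \<Sigma> V. thin_svd A U \<Sigma> V \<and> W = U ** transpose V)"

definition Retraction ::
    "real^'q^('m::finite \<times> 'd::finite) \<Rightarrow> real^'q^('m \<times> 'd) \<Rightarrow> real^'q^('m \<times> 'd)" where
  "Retraction Y D = (\<chi> r. svd_projection (slice (fst r) Y + slice (fst r) D) $ snd r)"

definition descent_direction ::
    "(real^('m::finite \<times> 'd::finite)^('m \<times> 'd) \<Rightarrow> real) \<Rightarrow>
     real^'q^('m \<times> 'd) \<Rightarrow> real^'q^('m \<times> 'd) \<Rightarrow> bool" where
  "descent_direction f Y D \<longleftrightarrow> D \<in> tangent_space Y \<and>
     (\<exists>t0>0. \<forall>t\<in>{0<..<t0}. g f (Retraction Y (t *\<^sub>R D)) < g f Y)"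

(* (Y 0): the p + k columns are indexed by the disjoint sum 'p + 'k. *)
definition append_zero_columns :: "real^'p^'n \<Rightarrow> real^('p::finite + 'k::finite)^'n" where
  "append_zero_columns Y = (\<chi> r c. case c of Inl j \<Rightarrow> Y $ r $ j | Inr _ \<Rightarrow> 0)"

(* The basis vector e_(p+1): the 1 sits at the first of the appended positions. *)
definition first_new_unit_vector :: "real^('p::finite + 'k::{finite,linorder})" where
  "first_new_unit_vector = axis (Inr (Min UNIV)) 1"

(* u v^T *)
definition outer :: "real^'n \<Rightarrow> real^'q \<Rightarrow> real^'q^'n" where
  "outer u v = (\<chi> r c. u $ r * v $ c)"

end

(* Let Z be a feasible point with Z e = 0 for a unit vector e, and D = u e^T.
   The i-th slice of Z + t D has Gram matrix I + t^2 u_i u_i^T, so the retraction multiplies that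
   slice by the inverse square root of this rank-one perturbation of the identity. Hence, with
   \<tau> = t^2, the Gram matrix of the retracted point is B(\<tau>) (X + \<tau> u u^T) B(\<tau>), where
   X = Z Z^T and B(\<tau>) is block diagonal and smooth at 0 with B(0) = I. The derivative at \<tau> = 0
   of f along this curve of symmetric matrices is u^T S(X) u, and its negativity gives descent.
   For Z = (Y 0) any unit vector e supported on the new columns satisfies Z e = 0. *)
theory Submission
  imports Defs
begin

section \<open>Matrix algebra: the trace inner product and rank-one matrices\<close>

text \<open>Supplies both the distributive laws collected below and the product rule for
  matrix-valued curves.\<close>

lemma bounded_bilinear_matrix_mult:
  "bounded_bilinear ((**) :: real^'b^'a \<Rightarrow> real^'c^'b \<Rightarrow> real^'c^'a)"
  unfolding bilinear_conv_bounded_bilinear [symmetric] bilinear_def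
  by (auto intro!: linearI simp: matrix_matrix_mult_def vec_eq_iff sum.distrib algebra_simps
      sum_distrib_left)

lemmas matrix_mult_linear =
  bounded_bilinear.add_left [OF bounded_bilinear_matrix_mult]
  bounded_bilinear.add_right [OF bounded_bilinear_matrix_mult]
  bounded_bilinear.diff_left [OF bounded_bilinear_matrix_mult]
  bounded_bilinear.diff_right [OF bounded_bilinear_matrix_mult]
  bounded_bilinear.scaleR_left [OF bounded_bilinear_matrix_mult]
  bounded_bilinear.scaleR_right [OF bounded_bilinear_matrix_mult]

lemma inner_matrix_eq_trace:
  fixes A B :: "real^'a^'b"
  shows "A \<bullet> B = trace (transpose A ** B)"
  unfolding inner_vec_def trace_def transpose_def matrix_matrix_mult_def
  by (simp, subst sum.swap, simp)

lemma inner_matrix_mult_left: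
  fixes A :: "real^'c^'a" and B :: "real^'b^'a" and C :: "real^'c^'b"
  shows "A \<bullet> (B ** C) = (transpose B ** A) \<bullet> C"
  by (simp add: inner_matrix_eq_trace matrix_transpose_mul matrix_mul_assoc)

lemma inner_transpose_matrix:
  fixes A B :: "real^'a^'b"
  shows "transpose A \<bullet> transpose B = A \<bullet> B"
  unfolding inner_vec_def transpose_def by (simp, subst sum.swap, simp)

lemma transpose_linear [simp]:
  fixes A B :: "real^'a^'b"
  shows "transpose (A + B) = transpose A + transpose B"
    and "transpose (A - B) = transpose A - transpose B"
    and "transpose (c *\<^sub>R A) = c *\<^sub>R transpose A"
  by (simp_all add: transpose_def vec_eq_iff)

lemma transpose_sum:
  fixes A :: "'i \<Rightarrow> real^'a^'b"
  shows "transpose (\<Sum>i\<in>I. A i) = (\<Sum>i\<in>I. transpose (A i))"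
  by (induction I rule: infinite_finite_induct) (simp_all add: transpose_def vec_eq_iff)

lemma transpose_outer [simp]: "transpose (outer u v) = outer v u"
  by (simp add: outer_def transpose_def vec_eq_iff)

lemma matrix_mult_outer: "A ** outer u v = outer (A *v u) v"
  by (simp add: outer_def matrix_matrix_mult_def matrix_vector_mult_def vec_eq_iff sum_distrib_right
      mult.assoc)

lemma outer_mult_transpose: "outer u v ** transpose A = outer u (A *v v)"
  by (simp add: outer_def matrix_matrix_mult_def matrix_vector_mult_def transpose_def vec_eq_iff
      sum_distrib_left mult_ac)

lemma outer_mult_vector: "outer u v *v w = (v \<bullet> w) *\<^sub>R u"
  by (simp add: outer_def matrix_vector_mult_def inner_vec_def vec_eq_iff sum_distrib_left mult_ac)

lemma outer_mult_outer: "outer u v ** outer w x = (v \<bullet> w) *\<^sub>R outer u x"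
  by (simp add: matrix_mult_outer outer_mult_vector) (simp add: outer_def vec_eq_iff)

lemma inner_outer: "M \<bullet> outer u v = u \<bullet> (M *v v)"
  by (simp add: outer_def inner_vec_def matrix_vector_mult_def sum_distrib_left mult_ac)

section \<open>The SVD projection as a polar factor, in closed form for rank-one
  perturbations\<close>

text \<open>Trades a thin SVD for a left polar decomposition: \<open>U ** D ** transpose U\<close>
  is a positive semidefinite square root of \<open>A ** transpose A\<close>, and
  \<open>U ** transpose V\<close> is the remaining isometric factor.\<close>

lemma thin_svd_positive_factor:
  assumes "thin_svd A U D V"
  obtains R where "\<And>x. 0 \<le> x \<bullet> (R *v x)" "A = R ** (U ** transpose V)"
    "R ** R = A ** transpose A"
proof
  let ?R = "U ** D ** transpose U"
  have U: "U ** transpose U = mat 1" "transpose U ** U = mat 1" and V: "transpose V ** V = mat 1"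
    and off: "\<And>a b. a \<noteq> b \<Longrightarrow> D $ a $ b = 0" and nonneg: "\<And>a. 0 \<le> D $ a $ a"
    and A: "A = U ** D ** transpose V"
    using assms by (auto simp: thin_svd_def orthogonal_matrix_def)
  have D: "transpose D = D"
    using off by (simp add: transpose_def vec_eq_iff) metis
  show "0 \<le> x \<bullet> (?R *v x)" for x
  proof -
    define y where "y = transpose U *v x"
    have "x \<bullet> (?R *v x) = y \<bullet> (D *v y)"
      by (simp add: y_def dot_lmul_matrix flip: matrix_vector_mul_assoc)
    also have "\<dots> = (\<Sum>a\<in>UNIV. y $ a * (\<Sum>b\<in>UNIV. D $ a $ b * y $ b))"
      by (simp add: inner_vec_def matrix_vector_mult_def)
    also have "\<dots> = (\<Sum>a\<in>UNIV. y $ a * (\<Sum>b\<in>UNIV. if a = b then D $ a $ a * y $ a else 0))"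
    proof -
      have "(\<Sum>b\<in>UNIV. D $ a $ b * y $ b) = (\<Sum>b\<in>UNIV. if a = b then D $ a $ a * y $ a else 0)"
        for a
        by (intro sum.cong) (auto simp: off)
      then show ?thesis by (simp only:)
    qed
    also have "\<dots> \<ge> 0"
      using nonneg by (auto intro!: sum_nonneg simp: mult.left_commute [of "y $ _" "D $ _ $ _"])
    finally show ?thesis .
  qed
  show "A = ?R ** (U ** transpose V)"
    using U by (metis A matrix_mul_assoc matrix_mul_rid)
  have "?R ** ?R = U ** D ** (transpose U ** U) ** D ** transpose U"
    by (simp only: matrix_mul_assoc)
  moreover have "A ** transpose A = U ** D ** (transpose V ** V) ** D ** transpose U"
    by (simp only: A matrix_transpose_mul D transpose_transpose matrix_mul_assoc)
  ultimately show "?R ** ?R = A ** transpose A"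
    by (simp add: U V)
qed

text \<open>Commutation makes the cross terms of \<open>(R + Q) ** (R - Q)\<close> cancel, leaving
  0, and \<open>R + Q\<close> is injective because its quadratic form is positive definite.\<close>

lemma commuting_square_root_unique:
  fixes R Q :: "real^'n^'n"
  assumes "R ** R = Q ** Q" "R ** Q = Q ** R"
    and R: "\<And>x. 0 \<le> x \<bullet> (R *v x)" and Q: "\<And>x. x \<noteq> 0 \<Longrightarrow> 0 < x \<bullet> (Q *v x)"
  shows "R = Q"
proof -
  have *: "(R + Q) ** (R - Q) = 0"
    using assms(1,2) by (simp add: matrix_mult_linear)
  have "(R - Q) *v y = 0" for y
  proof (rule ccontr)
    let ?x = "(R - Q) *v y"
    assume "?x \<noteq> 0"
    moreover have "(R + Q) *v ?x = 0"
      by (simp only: matrix_vector_mul_assoc * matrix_vector_mult_0)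
    then have "?x \<bullet> (R *v ?x) + ?x \<bullet> (Q *v ?x) = 0"
      by (metis inner_add_right inner_zero_right matrix_vector_mult_add_rdistrib)
    ultimately show False
      using R [of ?x] Q [of ?x] by linarith
  qed
  then have "R *v y = Q *v y" for y
    by (simp add: matrix_vector_mult_diff_rdistrib)
  then show ?thesis
    by (simp add: matrix_eq)
qed

text \<open>The Gram matrix has the explicit square root \<open>Q\<close>, a rank-one perturbation
  of the identity with inverse \<open>?N\<close>. Every thin SVD of \<open>A\<close> has
  \<open>Q\<close> as its positive factor, so its isometric factor is forced to be
  \<open>?N ** A\<close>.\<close>

lemma svd_projection_rank_one_perturbation:
  fixes A :: "real^'q^'d" and v :: "real^'d"
  assumes A: "A ** transpose A = mat 1 + \<tau> *\<^sub>R outer v v" and \<tau>: "0 \<le> \<tau>"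
  defines "r \<equiv> sqrt (1 + \<tau> * (v \<bullet> v))"
  shows "svd_projection A = (mat 1 - (\<tau> / (r * (r + 1))) *\<^sub>R outer v v) ** A"
    (is "_ = ?N ** A")
proof -
  have r: "r \<ge> 1" "r * r = 1 + \<tau> * (v \<bullet> v)"
    using \<tau> by (simp_all add: r_def)
  \<comment> \<open>Squaring \<open>I + c v v^T\<close> to \<open>I + \<tau> v v^T\<close> requires
    \<open>2 c + c^2 (v \<bullet> v) = \<tau>\<close>, hence
    \<open>c (v \<bullet> v) = r - 1\<close>. The form with denominator \<open>r + 1\<close> also
    covers \<open>v = 0\<close>.\<close>
  define c where "c = \<tau> / (r + 1)"
  have c: "c \<ge> 0" "c * (r + 1) = \<tau>" "\<tau> / (r * (r + 1)) = c / r"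
    using r \<tau> by (auto simp: c_def field_simps)
  have "c * (v \<bullet> v) * (r + 1) = (r - 1) * (r + 1)"
  proof -
    have "c * (v \<bullet> v) * (r + 1) = c * (r + 1) * (v \<bullet> v)" by simp
    also have "\<dots> = r * r - 1" using r c by simp
    finally show ?thesis by (simp add: algebra_simps)
  qed
  then have cs: "c * (v \<bullet> v) = r - 1"
    using r by simp
  define Q where "Q = mat 1 + c *\<^sub>R outer v v"
  have Qsym: "transpose Q = Q"
    by (simp add: Q_def)
  have QQ: "Q ** Q = A ** transpose A"
  proof -
    have "Q ** Q = mat 1 + (c + c + c * (c * (v \<bullet> v))) *\<^sub>R outer v v"
      by (simp add: Q_def matrix_mult_linear outer_mult_outer) (simp add: vec_eq_iff algebra_simps)
    also have "c + c + c * (c * (v \<bullet> v)) = \<tau>"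
      unfolding cs using c(2) by (simp add: algebra_simps)
    finally show ?thesis by (simp add: A)
  qed
  define N where "N = ?N"
  \<comment> \<open>The Sherman-Morrison coefficient for the inverse of \<open>Q\<close> is
    \<open>c / (1 + c (v \<bullet> v))\<close>, which equals \<open>c / r\<close>.\<close>
  have N: "N = mat 1 - (c / r) *\<^sub>R outer v v"
    by (simp add: N_def c)
  have NQ: "N ** Q = mat 1"
  proof -
    have "N ** Q = mat 1 + (c - c / r - (c / r) * (c * (v \<bullet> v))) *\<^sub>R outer v v"
      by (simp add: Q_def N matrix_mult_linear outer_mult_outer algebra_simps)
    also have "c - c / r - (c / r) * (c * (v \<bullet> v)) = 0"
      unfolding cs using r by (simp add: field_simps)
    finally show ?thesis by simp
  qed
  then have QN: "Q ** N = mat 1"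
    by (simp add: matrix_left_right_inverse)
  have Nsym: "transpose N = N"
    by (simp add: N)
  have NA: "N ** A ** transpose (N ** A) = mat 1"
  proof -
    have "N ** A ** transpose (N ** A) = N ** (A ** transpose A) ** N"
      by (simp only: matrix_transpose_mul Nsym matrix_mul_assoc)
    also have "\<dots> = (N ** Q) ** (Q ** N)"
      by (simp only: QQ [symmetric] matrix_mul_assoc)
    finally show ?thesis by (simp add: NQ QN)
  qed
  have unique: "U ** transpose V = N ** A" if svd: "thin_svd A U D V" for U D V
  proof -
    obtain R where R: "\<And>x. 0 \<le> x \<bullet> (R *v x)" "A = R ** (U ** transpose V)"
      "R ** R = A ** transpose A"
      using thin_svd_positive_factor [OF svd] by blast
    \<comment> \<open>As a polynomial in \<open>R ** R\<close>, the matrix \<open>Q\<close> commutes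
      with \<open>R\<close>.\<close>
    have "Q = mat 1 + (1 / (r + 1)) *\<^sub>R (R ** R - mat 1)"
      unfolding R(3) A by (simp add: Q_def c_def)
    then have comm: "R ** Q = Q ** R"
      by (simp add: matrix_mult_linear matrix_mul_assoc)
    have "R = Q"
    proof (rule commuting_square_root_unique)
      show "R ** R = Q ** Q" by (simp add: R QQ)
      show "0 < x \<bullet> (Q *v x)" if "x \<noteq> 0" for x
      proof -
        have "x \<bullet> (Q *v x) = x \<bullet> x + c * (v \<bullet> x)\<^sup>2"
          by (simp add: Q_def matrix_vector_mult_add_rdistrib outer_mult_vector inner_add_right
              power2_eq_square inner_commute flip: scaleR_matrix_vector_assoc)
        then show ?thesis
          using that c by (simp add: add_pos_nonneg)
      qed
    qed (use comm R in auto)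
    then have "N ** A = (N ** Q) ** (U ** transpose V)"
      unfolding R(2) by (simp only: matrix_mul_assoc)
    then show ?thesis by (simp add: NQ)
  qed
  \<comment> \<open>\<open>svd_projection\<close> is a choice, so some thin SVD must be exhibited.
    It comes from diagonalising \<open>Q\<close>: \<open>U\<close> turns a coordinate axis into the
    direction of \<open>v\<close>, and \<open>V\<close> is then read off from
    \<open>A = Q ** (N ** A)\<close>.\<close>
  have exists: "\<exists>U D V. thin_svd A U D V"
  proof -
    obtain U :: "real^'d^'d" and k s where U: "orthogonal_matrix U" and v: "v = s *\<^sub>R (U *v axis k 1)"
    proof (cases "v = 0")
      case True
      show ?thesis by (rule that [of "mat 1" 0]) (simp_all add: orthogonal_matrix_id True)
    next
      case False
      then have "norm (v /\<^sub>R norm v) = 1" by simp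
      then obtain U :: "real^'d^'d" where "orthogonal_matrix U" "U *v axis undefined 1 = v /\<^sub>R norm v"
        by (rule orthogonal_matrix_exists_basis)
      with False show ?thesis by (intro that [of U "norm v" undefined]) auto
    qed
    \<comment> \<open>These are the eigenvalues of \<open>Q\<close>:
      \<open>1 + c (v \<bullet> v)\<close> along \<open>v\<close>, since
      \<open>s^2 = v \<bullet> v\<close>, and 1 orthogonally to it.\<close>
    define D where "D = mat 1 + (c * s\<^sup>2) *\<^sub>R outer (axis k 1) (axis k (1::real))"
    have U': "U ** transpose U = mat 1" "transpose U ** U = mat 1"
      using U by (auto simp: orthogonal_matrix_def)
    have UDU: "U ** D ** transpose U = Q"
    proof -
      have "U ** D ** transpose U
          = mat 1 + (c * s\<^sup>2) *\<^sub>R outer (U *v axis k 1) (U *v axis k 1)"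
        by (simp add: D_def matrix_mult_linear matrix_mult_outer outer_mult_transpose U')
      also have "\<dots> = Q"
        by (simp add: Q_def v power2_eq_square outer_def vec_eq_iff)
      finally show ?thesis .
    qed
    define V where "V = transpose (N ** A) ** U"
    have VV: "transpose V ** V = mat 1"
    proof -
      have "transpose V ** V = transpose U ** (N ** A ** transpose (N ** A)) ** U"
        by (simp only: V_def matrix_transpose_mul transpose_transpose matrix_mul_assoc)
      then show ?thesis by (simp add: NA U')
    qed
    have UDV: "U ** D ** transpose V = A"
    proof -
      have "U ** D ** transpose V = (U ** D ** transpose U) ** N ** A"
        by (simp only: V_def matrix_transpose_mul transpose_transpose matrix_mul_assoc)
      then show ?thesis by (simp add: UDU QN)
    qed
    have "D $ a $ b = (if a = b then 1 else 0) + c * s\<^sup>2 * (if a = k \<and> b = k then 1 else 0)" for a b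
      by (simp add: D_def mat_def outer_def axis_def)
    then have "\<forall>a b. a \<noteq> b \<longrightarrow> D $ a $ b = 0" "\<forall>a. 0 \<le> D $ a $ a"
      using c(1) by simp_all
    then have "thin_svd A U D V"
      unfolding thin_svd_def using U VV UDV [symmetric] by blast
    then show ?thesis by blast
  qed
  have "\<exists>U D V. thin_svd A U D V \<and> svd_projection A = U ** transpose V"
    unfolding svd_projection_def by (rule someI_ex) (use exists in blast)
  then show "svd_projection A = ?N ** A"
    using unique by (auto simp: N_def)
qed

section \<open>Differentiation along curves and the gradient on symmetric matrices\<close>

text \<open>The curve never leaves \<open>E\<close>, so a derivative within \<open>E\<close>
  suffices for the chain rule and still yields a two-sided derivative in the parameter.\<close>

lemma has_real_derivative_along_curve:
  fixes f :: "'a::real_normed_vector \<Rightarrow> real"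
  assumes f: "(f has_derivative D) (at (c 0) within E)"
    and c: "(c has_vector_derivative c') (at 0)" and E: "\<And>s. c s \<in> E"
  shows "((\<lambda>s. f (c s)) has_real_derivative D c') (at 0)"
proof -
  have "(f has_derivative D) (at (c 0) within range c)"
    by (rule has_derivative_subset [OF f]) (use E in auto)
  then have "((\<lambda>s. f (c s)) has_derivative (\<lambda>s. D (s *\<^sub>R c'))) (at 0)"
    using c unfolding has_vector_derivative_def by (rule has_derivative_in_compose [rotated])
  moreover have "D (s *\<^sub>R c') = D c' * s" for s
    using has_derivative_linear [OF f] by (simp add: linear_cmul)
  ultimately show ?thesis
    by (simp add: has_field_derivative_def)
qed

text \<open>The difference of two candidates is itself a symmetric direction. Differentiating
  \<open>f\<close> along it shows that the difference is orthogonal to itself.\<close>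

lemma has_derivative_within_symmetric_gradient_unique:
  fixes f :: "real^'n^'n \<Rightarrow> real"
  assumes X: "X \<in> symmetric_matrices"
    and G: "G \<in> symmetric_matrices"
      "(f has_derivative (\<lambda>H. trace (transpose G ** H))) (at X within symmetric_matrices)"
    and G': "G' \<in> symmetric_matrices"
      "(f has_derivative (\<lambda>H. trace (transpose G' ** H))) (at X within symmetric_matrices)"
  shows "G = G'"
proof -
  define H where "H = G - G'"
  have H: "transpose H = H"
    using G(1) G'(1) by (simp add: symmetric_matrices_def H_def)
  have c: "((\<lambda>s. X + s *\<^sub>R H) has_vector_derivative H) (at 0)"
    by (auto intro!: derivative_eq_intros)
  have "X + s *\<^sub>R H \<in> symmetric_matrices" for s
    using X H by (simp add: symmetric_matrices_def)
  then have "((\<lambda>s. f (X + s *\<^sub>R H)) has_real_derivative K \<bullet> H) (at 0)"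
    if "(f has_derivative (\<lambda>H. trace (transpose K ** H))) (at X within symmetric_matrices)" for K
    using has_real_derivative_along_curve [where c = "\<lambda>s. X + s *\<^sub>R H", OF _ c, of f _ symmetric_matrices]
      that
    by (simp add: inner_matrix_eq_trace)
  from this [OF G(2)] this [OF G'(2)] have "G \<bullet> H = G' \<bullet> H"
    by (rule DERIV_unique)
  then have "H \<bullet> H = 0"
    by (simp add: H_def inner_diff_left)
  then show ?thesis
    by (simp add: H_def)
qed

text \<open>Justifies the definite description in \<open>gradient\<close>. The derivative is
  represented by some matrix, and symmetrising that matrix leaves its pairing with symmetric
  directions unchanged.\<close>

lemma has_derivative_gradient:
  fixes f :: "real^'n^'n \<Rightarrow> real"
  assumes X: "X \<in> symmetric_matrices"
    and f: "(f has_derivative D) (at X within symmetric_matrices)"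
  shows "gradient f X \<in> symmetric_matrices"
    and "(f has_derivative (\<lambda>H. gradient f X \<bullet> H)) (at X within symmetric_matrices)"
proof -
  \<comment> \<open>Riesz representation: the adjoint of a linear functional, applied to 1, is its
    representing vector.\<close>
  define M where "M = adjoint D 1"
  have M: "D H = M \<bullet> H" for H
    using adjoint_works [OF has_derivative_linear [OF f], of H 1] by (simp add: M_def inner_commute)
  define G where "G = (1/2) *\<^sub>R (M + transpose M)"
  have G: "G \<in> symmetric_matrices"
    by (simp add: G_def symmetric_matrices_def add.commute)
  have GH: "G \<bullet> H = D H" if "H \<in> symmetric_matrices" for H
  proof -
    have "transpose M \<bullet> H = M \<bullet> H"
      using that inner_transpose_matrix [of M H] by (simp add: symmetric_matrices_def)
    then show ?thesis
      by (simp add: G_def M inner_add_left)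
  qed
  have "(f has_derivative (\<lambda>H. G \<bullet> H)) (at X within symmetric_matrices)"
    unfolding has_derivative_within
  proof
    show "bounded_linear ((\<bullet>) G)"
      by (rule bounded_linear_inner_right)
    have "((\<lambda>y. (1 / norm (y - X)) *\<^sub>R (f y - (f X + D (y - X)))) \<longlongrightarrow> 0)
        (at X within symmetric_matrices)"
      using f by (simp add: has_derivative_within)
    \<comment> \<open>Within the symmetric matrices every increment is symmetric, so
      \<open>D\<close> may be replaced by pairing with \<open>G\<close> in the difference
      quotient.\<close>
    moreover have "\<forall>\<^sub>F y in at X within symmetric_matrices. D (y - X) = G \<bullet> (y - X)"
      using X by (auto simp: eventually_at_filter GH symmetric_matrices_def)
    ultimately show "((\<lambda>y. (1 / norm (y - X)) *\<^sub>R (f y - (f X + G \<bullet> (y - X)))) \<longlongrightarrow> 0)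
        (at X within symmetric_matrices)"
      by (auto elim!: Lim_transform_eventually elim: eventually_mono)
  qed
  then have "\<exists>!G. G \<in> symmetric_matrices \<and>
      (f has_derivative (\<lambda>H. trace (transpose G ** H))) (at X within symmetric_matrices)"
    using G has_derivative_within_symmetric_gradient_unique [OF X]
    by (auto simp: inner_matrix_eq_trace)
  then have "gradient f X \<in> symmetric_matrices \<and>
      (f has_derivative (\<lambda>H. trace (transpose (gradient f X) ** H))) (at X within symmetric_matrices)"
    unfolding gradient_def
    by (rule theI')
  then show "gradient f X \<in> symmetric_matrices"
    and "(f has_derivative (\<lambda>H. gradient f X \<bullet> H)) (at X within symmetric_matrices)"
    by (simp_all add: inner_matrix_eq_trace)
qed

section \<open>Block structure and the retraction along a rank-one direction\<close>

definition block_vec :: "'m \<Rightarrow> real^('m::finite \<times> 'd::finite) \<Rightarrow> real^'d" where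
  "block_vec i u = (\<chi> a. u $ (i, a))"

definition block_outer ::
    "'m \<Rightarrow> real^('m::finite \<times> 'd::finite) \<Rightarrow> real^('m \<times> 'd)^('m \<times> 'd)" where
  "block_outer i u = (\<chi> r c. if fst r = i \<and> fst c = i then u $ r * u $ c else 0)"

lemma transpose_block_outer [simp]: "transpose (block_outer i u) = block_outer i u"
  by (auto simp: block_outer_def transpose_def vec_eq_iff)

lemma sum_over_block:
  fixes h :: "'m::finite \<times> 'd::finite \<Rightarrow> real"
  shows "(\<Sum>r\<in>UNIV. if fst r = i then h r else 0) = (\<Sum>b\<in>UNIV. h (i, b))"
proof -
  have "(\<Sum>r\<in>UNIV. if fst r = i then h r else 0)
      = (\<Sum>j\<in>UNIV. \<Sum>b\<in>UNIV. if j = i then h (j, b) else 0)"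
    by (simp add: sum.cartesian_product flip: UNIV_Times_UNIV) (auto intro!: sum.cong)
  also have "\<dots> = (\<Sum>j\<in>UNIV. if j = i then (\<Sum>b\<in>UNIV. h (j, b)) else 0)"
    by (intro sum.cong) auto
  finally show ?thesis by simp
qed

lemma slice_linear [simp]:
  "slice i (A + B) = slice i A + slice i B"
  "slice i (A - B) = slice i A - slice i B"
  "slice i (c *\<^sub>R A) = c *\<^sub>R slice i A"
  by (simp_all add: slice_def vec_eq_iff)

lemma slice_sum: "slice i (\<Sum>j\<in>J. A j) = (\<Sum>j\<in>J. slice i (A j))"
  by (induction J rule: infinite_finite_induct) (simp_all add: slice_def vec_eq_iff)

lemma slice_outer: "slice i (outer u v) = outer (block_vec i u) v"
  by (simp add: slice_def outer_def block_vec_def vec_eq_iff)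

lemma slice_mult_vector: "slice i A *v x = block_vec i (A *v x)"
  by (simp add: slice_def block_vec_def matrix_vector_mult_def vec_eq_iff)

lemma slice_block_outer_mult:
  "slice i (block_outer j u ** Z)
    = (if j = i then outer (block_vec i u) (block_vec i u) ** slice i Z else 0)"
proof (cases "j = i")
  case True
  have "(\<Sum>k\<in>UNIV. (if fst k = i then u $ (i, a) * u $ k else 0) * Z $ k $ c)
      = (\<Sum>b\<in>UNIV. u $ (i, a) * u $ (i, b) * Z $ (i, b) $ c)" for a c
    by (subst sum_over_block [symmetric]) (auto intro!: sum.cong)
  with True show ?thesis
    by (simp add: slice_def block_outer_def outer_def block_vec_def matrix_matrix_mult_def vec_eq_iff)
next
  case False
  then show ?thesis
    by (simp add: slice_def block_outer_def matrix_matrix_mult_def vec_eq_iff)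
qed

text \<open>The diagonal blocks of \<open>retraction_factor \<tau> u\<close> are the inverse square roots of
  \<open>I + \<tau> u\<^sub>i u\<^sub>i\<^sup>T\<close>, in closed form and without dividing by the norm of \<open>u\<^sub>i\<close>.\<close>

definition retraction_coeff :: "real \<Rightarrow> real \<Rightarrow> real" where
  "retraction_coeff s \<tau> = \<tau> / (sqrt (1 + \<tau> * s) * (sqrt (1 + \<tau> * s) + 1))"

definition retraction_factor ::
    "real^('m::finite \<times> 'd::finite) \<Rightarrow> real \<Rightarrow> real^('m \<times> 'd)^('m \<times> 'd)" where
  "retraction_factor u \<tau> = mat 1 -
    (\<Sum>i\<in>UNIV. retraction_coeff (block_vec i u \<bullet> block_vec i u) \<tau> *\<^sub>R block_outer i u)"

lemma transpose_retraction_factor [simp]: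
  "transpose (retraction_factor u \<tau>) = retraction_factor u \<tau>"
  by (simp add: retraction_factor_def transpose_sum)

lemma slice_retraction_factor_mult:
  "slice i (retraction_factor u \<tau> ** Z)
    = (mat 1 - retraction_coeff (block_vec i u \<bullet> block_vec i u) \<tau>
        *\<^sub>R outer (block_vec i u) (block_vec i u)) ** slice i Z"
proof -
  have "slice i (retraction_factor u \<tau> ** Z) = slice i Z -
      (\<Sum>j\<in>UNIV. retraction_coeff (block_vec j u \<bullet> block_vec j u) \<tau>
         *\<^sub>R slice i (block_outer j u ** Z))"
    by (simp add: retraction_factor_def matrix_mult_linear slice_sum
        bounded_bilinear.sum_left [OF bounded_bilinear_matrix_mult])
  also have "\<dots> = slice i Z - (\<Sum>j\<in>UNIV. if j = i then
      retraction_coeff (block_vec i u \<bullet> block_vec i u) \<tau>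
         *\<^sub>R (outer (block_vec i u) (block_vec i u) ** slice i Z) else 0)"
    by (intro arg_cong2 [where f = "(-)"] sum.cong) (auto simp: slice_block_outer_mult)
  finally show ?thesis
    by (simp add: matrix_mult_linear)
qed

text \<open>Because \<open>Z *v e = 0\<close>, the cross terms in each slice's Gram matrix vanish.
  What remains is the identity plus \<open>t^2\<close> times a rank-one matrix, to which the closed
  form of \<open>svd_projection\<close> applies.\<close>

lemma Retraction_outer:
  fixes Z :: "real^'q^('m::finite \<times> 'd::finite)"
  assumes Z: "Z \<in> St" and e: "Z *v e = 0" "e \<bullet> e = 1"
  shows "Retraction Z (t *\<^sub>R outer u e) = retraction_factor u (t\<^sup>2) ** (Z + t *\<^sub>R outer u e)"
proof -
  have "svd_projection (slice i Z + slice i (t *\<^sub>R outer u e))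
      = slice i (retraction_factor u (t\<^sup>2) ** (Z + t *\<^sub>R outer u e))" for i
  proof -
    let ?v = "block_vec i u" and ?A = "slice i Z + slice i (t *\<^sub>R outer u e)"
    have ZZ: "slice i Z ** transpose (slice i Z) = mat 1"
      using Z by (simp add: St_def)
    have Ze: "slice i Z *v e = 0"
      by (simp add: slice_mult_vector e block_vec_def vec_eq_iff)
    have outer_zero: "outer (0::real^'d) ?v = 0" "outer ?v (0::real^'d) = 0"
      by (simp_all add: outer_def vec_eq_iff)
    have "?A ** transpose ?A = mat 1 + t\<^sup>2 *\<^sub>R outer ?v ?v"
      by (simp only: slice_outer slice_linear transpose_linear transpose_outer matrix_mult_linear ZZ)
        (simp add: matrix_mult_outer outer_mult_transpose Ze outer_mult_vector outer_zero e
          power2_eq_square)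
    from svd_projection_rank_one_perturbation [OF this] show ?thesis
      by (simp add: slice_retraction_factor_mult retraction_coeff_def)
  qed
  then show ?thesis
    by (simp add: Retraction_def vec_eq_iff) (simp add: slice_def)
qed

text \<open>At \<open>\<tau> = 0\<close> the denominator in \<open>retraction_coeff\<close> equals
  2, so every coefficient has derivative 1/2, whatever the norm of its block of
  \<open>u\<close>.\<close>

lemma has_vector_derivative_retraction_factor:
  "(retraction_factor u has_vector_derivative - ((1/2) *\<^sub>R (\<Sum>i\<in>UNIV. block_outer i u))) (at 0)"
proof -
  have coeff: "(retraction_coeff s has_real_derivative 1/2) (at 0)" for s
    unfolding retraction_coeff_def by (auto intro!: derivative_eq_intros)
  have "((\<lambda>\<tau>. retraction_coeff s \<tau> *\<^sub>R M) has_vector_derivative (1/2) *\<^sub>R M) (at 0)"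
    for s and M :: "real^('a \<times> 'b)^('a \<times> 'b)"
    using bounded_linear.has_vector_derivative [OF bounded_linear_scaleR_left [of M],
        of "retraction_coeff s" "1/2" "at 0"] coeff [of s]
    unfolding has_real_derivative_iff_has_vector_derivative by blast
  from has_vector_derivative_diff [OF has_vector_derivative_const has_vector_derivative_sum [OF this]]
  show ?thesis
    unfolding retraction_factor_def [abs_def] by (simp add: scaleR_sum_right)
qed

text \<open>The sum of the \<open>block_outer i u\<close> is the block-diagonal part of
  \<open>outer u u\<close>, the only part that a block-diagonal matrix sees. This matches the
  derivative of the retraction factors with the correction term in \<open>S\<close>.\<close>

lemma inner_symblockdiag_outer:
  "symblockdiag M \<bullet> outer u u = (1/2) * ((M + transpose M) \<bullet> (\<Sum>i\<in>UNIV. block_outer i u))"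
proof -
  have K: "(\<Sum>i\<in>UNIV. block_outer i u) $ r $ c = (if fst r = fst c then u $ r * u $ c else 0)"
    for r c
  proof -
    have "(\<Sum>i\<in>UNIV. block_outer i u) $ r $ c
        = (\<Sum>i\<in>UNIV. if i = fst r then (if fst r = fst c then u $ r * u $ c else 0) else 0)"
      unfolding sum_component by (intro sum.cong) (auto simp: block_outer_def)
    then show ?thesis by simp
  qed
  show ?thesis
    unfolding inner_vec_def sum_distrib_left K
    by (intro sum.cong refl) (auto simp: symblockdiag_def outer_def blk_def transpose_def)
qed

section \<open>Padding with zero columns\<close>

lemma append_zero_columns_mult_transpose:
  "append_zero_columns Y ** transpose (append_zero_columns Y) = Y ** transpose Y"
  by (simp add: append_zero_columns_def matrix_matrix_mult_def transpose_def vec_eq_iff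
      sum.Plus flip: UNIV_Plus_UNIV)

lemma mult_append_zero_columns: "M ** append_zero_columns Y = append_zero_columns (M ** Y)"
  by (auto simp: append_zero_columns_def matrix_matrix_mult_def vec_eq_iff split: sum.split)

text \<open>Membership depends on \<open>Y\<close> only through its Gram matrix, so it passes
  between matrices with different numbers of columns.\<close>

lemma mem_St_iff: "Y \<in> St \<longleftrightarrow> (\<forall>i. blk i i (Y ** transpose Y) = mat 1)"
  by (simp add: St_def slice_def blk_def matrix_matrix_mult_def transpose_def)

lemma append_zero_columns_first_new_unit_vector:
  "append_zero_columns Y *v first_new_unit_vector = 0"
  by (simp add: first_new_unit_vector_def matrix_vector_mult_basis column_def
      append_zero_columns_def vec_eq_iff)

section \<open>Descent along a rank-one direction\<close>

text \<open>Along the retraction, \<open>g\<close> depends on \<open>t\<close> only through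
  \<open>t^2\<close>, so its first derivative in \<open>t\<close> vanishes at 0. Taking
  \<open>t^2\<close> as the parameter turns the second-order decrease into a first-order
  one.\<close>

lemma descent_direction_outer:
  fixes f :: "real^('m::finite \<times> 'd::finite)^('m \<times> 'd) \<Rightarrow> real"
    and Z :: "real^'q^('m \<times> 'd)"
  assumes f: "(f has_derivative D) (at (Z ** transpose Z) within symmetric_matrices)"
    and Z: "Z \<in> St" and e: "Z *v e = 0" "e \<bullet> e = 1"
    and u: "u \<bullet> (S f (Z ** transpose Z) *v u) < 0"
  shows "outer u e \<in> tangent_space Z" and "descent_direction f Z (outer u e)"
proof -
  define X where "X = Z ** transpose Z"
  have X: "transpose X = X"
    by (simp add: X_def matrix_transpose_mul)
  have outer_zero: "outer u (0::real^('m \<times> 'd)) = 0" "outer (0::real^('m \<times> 'd)) u = 0"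
    by (simp_all add: outer_def vec_eq_iff)
  have tangent: "outer u e ** transpose Z = 0" "Z ** outer e u = 0"
    by (simp_all add: outer_mult_transpose matrix_mult_outer e outer_zero)
  then show mem: "outer u e \<in> tangent_space Z"
    unfolding tangent_space_def mem_Collect_eq transpose_outer
    by (simp only:) (simp add: symblockdiag_def blk_def transpose_def vec_eq_iff)
  define curve where
    "curve \<tau> = retraction_factor u \<tau> ** (X + \<tau> *\<^sub>R outer u u) ** retraction_factor u \<tau>" for \<tau>
  have g_Retraction: "g f (Retraction Z (t *\<^sub>R outer u e)) = f (curve (t\<^sup>2))" for t
  proof -
    have "(Z + t *\<^sub>R outer u e) ** transpose (Z + t *\<^sub>R outer u e) = X + t\<^sup>2 *\<^sub>R outer u u"
      by (simp add: matrix_mult_linear tangent outer_mult_outer e X_def power2_eq_square)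
    moreover have "Retraction Z (t *\<^sub>R outer u e) ** transpose (Retraction Z (t *\<^sub>R outer u e))
        = retraction_factor u (t\<^sup>2) ** ((Z + t *\<^sub>R outer u e) ** transpose (Z + t *\<^sub>R outer u e))
          ** retraction_factor u (t\<^sup>2)"
      by (simp only: Retraction_outer [OF Z e] matrix_transpose_mul transpose_retraction_factor
          matrix_mul_assoc)
    ultimately show ?thesis
      by (simp add: g_def curve_def)
  qed
  have curve0: "curve 0 = X"
    by (simp add: curve_def retraction_factor_def retraction_coeff_def)
  define K where "K = (\<Sum>i\<in>UNIV. block_outer i u)"
  \<comment> \<open>By the product rule: both outer factors of \<open>curve\<close> are the identity
    at 0 with derivative \<open>- K / 2\<close>, and the middle factor contributes
    \<open>outer u u\<close>.\<close>
  define H where "H = outer u u - (1/2) *\<^sub>R (K ** X + X ** K)"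
  have "(curve has_vector_derivative H) (at 0)"
  proof -
    note mult = bounded_bilinear.has_vector_derivative [OF bounded_bilinear_matrix_mult]
    have factor0: "retraction_factor u 0 = mat 1"
      by (simp add: retraction_factor_def retraction_coeff_def)
    have "((\<lambda>\<tau>. X + \<tau> *\<^sub>R outer u u) has_vector_derivative outer u u) (at 0)"
      by (auto intro!: derivative_eq_intros)
    from mult [OF mult [OF has_vector_derivative_retraction_factor [of u] this]
        has_vector_derivative_retraction_factor [of u]]
    show ?thesis
      unfolding curve_def [abs_def]
      by (rule has_vector_derivative_eq_rhs)
        (simp add: factor0 H_def K_def [symmetric] matrix_mult_linear
          bounded_bilinear.minus_left [OF bounded_bilinear_matrix_mult]
          bounded_bilinear.minus_right [OF bounded_bilinear_matrix_mult] algebra_simps)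
  qed
  moreover define G where "G = gradient f X"
  have "X \<in> symmetric_matrices"
    using X by (simp add: symmetric_matrices_def)
  note grad = has_derivative_gradient [OF this f [folded X_def], folded G_def]
  \<comment> \<open>Symmetry holds for every real \<open>\<tau>\<close>, negative values included,
    even where the square roots have no geometric meaning; this permits a two-sided derivative at
    0.\<close>
  moreover have "curve \<tau> \<in> symmetric_matrices" for \<tau>
    by (simp add: curve_def symmetric_matrices_def matrix_transpose_mul X matrix_mul_assoc)
  ultimately have deriv: "((\<lambda>\<tau>. f (curve \<tau>)) has_real_derivative G \<bullet> H) (at 0)"
    by (intro has_real_derivative_along_curve [where E = symmetric_matrices]) (simp_all add: curve0)
  have G: "transpose G = G"
    using grad(1) by (simp add: symmetric_matrices_def)
  \<comment> \<open>Moves \<open>X\<close> across the trace inner product, using symmetry of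
    \<open>G\<close>, \<open>X\<close> and \<open>K\<close>, so that \<open>K\<close> is paired with
    the symmetrisation of \<open>G ** X\<close>.\<close>
  have "G \<bullet> H = G \<bullet> outer u u - (1/2) * ((G ** X + X ** G) \<bullet> K)"
  proof -
    have K: "transpose K = K"
      by (simp add: K_def transpose_sum)
    have XK: "G \<bullet> (X ** K) = (X ** G) \<bullet> K"
      by (simp add: inner_matrix_mult_left X)
    moreover have "G \<bullet> (K ** X) = (G ** X) \<bullet> K"
      using XK inner_transpose_matrix [of G "K ** X"] inner_transpose_matrix [of "G ** X" K]
      by (simp add: matrix_transpose_mul G X K)
    ultimately show ?thesis
      by (simp add: H_def inner_diff_right inner_add_right inner_add_left)
  qed
  also have "\<dots> = S f X \<bullet> outer u u"
    by (simp add: S_def G_def [symmetric] inner_diff_left inner_symblockdiag_outer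
        matrix_transpose_mul G X K_def)
  also have "\<dots> < 0"
    using u by (simp add: inner_outer X_def)
  finally have "G \<bullet> H < 0" .
  from has_real_derivative_neg_dec_right [OF deriv this]
  obtain d where d: "d > 0" "\<And>h. 0 < h \<Longrightarrow> h < d \<Longrightarrow> f (curve h) < f (curve 0)"
    by auto
  \<comment> \<open>A decrease for parameters in \<open>(0, d)\<close> becomes a decrease for steps
    in \<open>(0, sqrt d)\<close>, since the parameter is \<open>t^2\<close>.\<close>
  have "g f (Retraction Z (t *\<^sub>R outer u e)) < g f Z" if "t \<in> {0<..<sqrt d}" for t
  proof -
    have "t\<^sup>2 < d"
      using that d(1) by (metis greaterThanLessThan_iff less_eq_real_def real_less_rsqrt
          real_sqrt_less_iff real_sqrt_abs abs_of_pos)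
    then show ?thesis
      using d(2) [of "t\<^sup>2"] that by (simp add: g_Retraction curve0) (simp add: g_def X_def)
  qed
  with d(1) mem show "descent_direction f Z (outer u e)"
    unfolding descent_direction_def by (intro conjI exI [of _ "sqrt d"]) auto
qed

theorem corollary3p10:
  fixes f :: "real^('m::finite \<times> 'd::finite)^('m \<times> 'd) \<Rightarrow> real"
    and Y :: "real^'p::finite^('m \<times> 'd)"
    and X :: "real^('m \<times> 'd)^('m \<times> 'd)"
    and Yplus :: "real^('p + 'k::{finite,linorder})^('m \<times> 'd)"
  assumes "CARD('d) \<le> CARD('p)" and "CARD('p) \<le> CARD('m) * CARD('d)"
    and "twice_continuously_differentiable_on symmetric_matrices f"
    and "Y \<in> St" and "rank Y = CARD('p)" and "critical_point f Y"
    and "X = Y ** transpose Y" and "\<not> KKT_point f X"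
    and "Yplus = append_zero_columns Y"
  shows "Yplus \<in> St
    \<and> g f Yplus = g f Y
    \<and> critical_point f Yplus
    \<and> (\<forall>u. u \<bullet> (S f X *v u) < 0 \<longrightarrow>
          outer u first_new_unit_vector \<in> tangent_space Yplus
          \<and> descent_direction f Yplus (outer u first_new_unit_vector))"
proof -
  have YY: "Yplus ** transpose Yplus = X"
    using assms by (simp add: append_zero_columns_mult_transpose)
  have St: "Yplus \<in> St"
    using \<open>Y \<in> St\<close> \<open>X = _\<close> by (simp add: mem_St_iff YY)
  have g: "g f Yplus = g f Y"
    using \<open>X = _\<close> by (simp add: g_def YY)
  \<comment> \<open>Both points share the Gram matrix \<open>X\<close> and hence
    \<open>S f X\<close>, which acts column by column: it kills the columns of \<open>Y\<close> by
    criticality and the new columns because they are zero.\<close>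
  have "S f X ** Yplus = append_zero_columns (0 :: real^'p^('m \<times> 'd))"
    using assms(6,7,9) by (simp add: mult_append_zero_columns critical_point_def)
  also have "\<dots> = 0"
    by (auto simp: append_zero_columns_def vec_eq_iff split: sum.split)
  finally have crit: "critical_point f Yplus"
    by (simp add: critical_point_def St YY)
  have "X \<in> symmetric_matrices"
    using \<open>X = _\<close> by (simp add: symmetric_matrices_def matrix_transpose_mul)
  then obtain D where "(f has_derivative D) (at X within symmetric_matrices)"
    using assms(3) unfolding twice_continuously_differentiable_on_def by blast
  moreover have "Yplus *v first_new_unit_vector = 0"
    using assms(9) by (simp add: append_zero_columns_first_new_unit_vector)
  moreover have "first_new_unit_vector \<bullet> (first_new_unit_vector :: real^('p + 'k)) = 1"
    by (simp add: first_new_unit_vector_def inner_axis_axis)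
  ultimately show ?thesis
    using St g crit descent_direction_outer [of f _ Yplus first_new_unit_vector] by (auto simp: YY)
qed

end
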